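(* Let $p$ be a prime and $r>1$ an integer. Let $\mathcal{C}=\mathcal{C}_0\oplus p\,\mathcal{C}_1\oplus\cdots\oplus p^{r-1}\mathcal{C}_{r-1}$ be a convolutional code of length $n$ over $\mathbb{Z}_{p^r}((D))$, where each $\mathcal{C}_i$, $i=0,1,\dots,r-1$, is a free convolutional code of length $n$, and where the sum $\mathcal{C}_0+\mathcal{C}_1+\cdots+\mathcal{C}_{r-1}$ is direct, i.e. $\mathcal{C}_0+\cdots+\mathcal{C}_{r-1}=\mathcal{C}_0\oplus\cdots\oplus\mathcal{C}_{r-1}$, and is a free convolutional code. Then there exists a family $B_0,B_1,\dots,B_{r-1}$ of free convolutional codes of length $n$ over $\mathbb{Z}_{p^r}((D))$ such that $$\mathcal{C}^{\perp}=B_0\oplus p\,B_1\oplus\cdots\oplus p^{r-1}B_{r-1}$$ and 1. $B_0=(\mathcal{C}_0\oplus\cdots\oplus\mathcal{C}_{r-1})^{\perp}$; 2. for each $i\in\{1,\dots,r-1\}$, $\operatorname{rank}(B_i)=\operatorname{rank}(\mathcal{C}_{r-i})$.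
   Context: $\mathbb{Z}_{p^r}$ is the ring of integers modulo $p^r$; $\mathbb{Z}_{p^r}[D]$ and $\mathbb{Z}_{p^r}((D))$ are the rings of polynomials and of Laurent series (finitely many negative powers of $D$) over it. Vectors are row vectors. A convolutional code $\mathcal{C}$ of length $n$ over $\mathbb{Z}_{p^r}((D))$ is a $\mathbb{Z}_{p^r}((D))$-submodule of $\mathbb{Z}_{p^r}^n((D))$ for which there is a polynomial matrix $G(D)\in\mathbb{Z}_{p^r}^{\tilde k\times n}[D]$ (for some $\tilde k$) with $\mathcal{C}=\{u(D)G(D): u(D)\in\mathbb{Z}_{p^r}^{\tilde k}((D))\}$. It is free if it is a free $\mathbb{Z}_{p^r}((D))$-module; its rank is then its rank as a free module. The dual (orthogonal) is $\mathcal{C}^{\perp}=\{y\in\mathbb{Z}_{p^r}^n((D)) : [y,x]=0 \text{ for all } x\in\mathcal{C}\}$, where $[y,x]=\sum_{i=1}^n y_ix_i\in\mathbb{Z}_{p^r}((D))$. Direct sums are internal direct sums of submodules of $\mathbb{Z}_{p^r}^n((D))$. *)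

theory Defs
  imports
    "HOL-Analysis.Analysis"
    "HOL-Library.Set_Algebras"
    "HOL-Computational_Algebra.Formal_Laurent_Series"
    "HOL-Computational_Algebra.Polynomial_FPS"
    "Berlekamp_Zassenhaus.Finite_Field"
begin

text \<open>
  The ring of integers modulo \<open>p ^ r\<close> is rendered as \<open>'a mod_ring\<close> with \<open>CARD('a) = p ^ r\<close>,
  its Laurent series ring in \<open>D\<close> as \<open>'a mod_ring fls\<close>, and row vectors of length \<open>n\<close> over
  the latter as \<open>'a mod_ring fls ^ 'n\<close> with \<open>n = CARD('n)\<close>.
  The definitions below are made over an arbitrary commutative coefficient ring.
\<close>

text \<open>The module structure of \<open>R^n\<close> for a commutative ring \<open>R\<close>: the interpretation \<open>vec\<close> of
  the library covers fields only.\<close>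

interpretation cvec: Modules.module "(*s) :: 'a::comm_ring_1 \<Rightarrow> 'a ^ 'n \<Rightarrow> 'a ^ 'n"
  by standard (simp_all add: vec_eq_iff algebra_simps)

definition free_submodule :: "('a::comm_ring_1 ^ 'n) set \<Rightarrow> bool" where
  "free_submodule M \<longleftrightarrow> (\<exists>B. cvec.independent B \<and> cvec.span B = M)"

text \<open>Meaningful for finitely generated free modules (hence for all free convolutional codes):
  over a nontrivial commutative ring all bases of such a module are finite and equinumerous.\<close>

definition free_rank :: "('a::comm_ring_1 ^ 'n) set \<Rightarrow> nat" where
  "free_rank M = card (SOME B. cvec.independent B \<and> cvec.span B = M)"

definition poly_to_fls :: "'a::comm_ring_1 poly \<Rightarrow> 'a fls" where
  "poly_to_fls g = fps_to_fls (fps_of_poly g)"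

text \<open>The \<open>k \<times> n\<close> generator matrix is \<open>G\<close> restricted to row indices below \<open>k\<close>, where \<open>k\<close> is an
  arbitrary natural number; the vector on the right-hand side is the product \<open>u G\<close>.\<close>

definition convolutional_code :: "('a::comm_ring_1 fls ^ 'n) set \<Rightarrow> bool" where
  "convolutional_code C \<longleftrightarrow> cvec.subspace C \<and>
     (\<exists>(k::nat) (G :: nat \<Rightarrow> 'n \<Rightarrow> 'a poly).
        C = range (\<lambda>u :: nat \<Rightarrow> 'a fls. \<chi> j. \<Sum>i<k. u i * poly_to_fls (G i j)))"

definition free_convolutional_code :: "('a::comm_ring_1 fls ^ 'n) set \<Rightarrow> bool" where
  "free_convolutional_code C \<longleftrightarrow> convolutional_code C \<and> free_submodule C"

definition dual_code :: "('a::comm_ring_1 fls ^ 'n) set \<Rightarrow> ('a fls ^ 'n) set" where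
  "dual_code C = {y. \<forall>x\<in>C. (\<Sum>i\<in>UNIV. y $ i * x $ i) = 0}"

text \<open>The sum of the submodules \<open>M i\<close> is direct. Here and below, sums of sets are
  the elementwise (Minkowski) sums of \<open>Set_Algebras\<close>, with \<open>{0}\<close> as empty sum.\<close>

definition direct_family :: "'i set \<Rightarrow> ('i \<Rightarrow> ('a::comm_ring_1 ^ 'n) set) \<Rightarrow> bool" where
  "direct_family I M \<longleftrightarrow> (\<forall>i\<in>I. M i \<inter> (\<Sum>j\<in>I - {i}. M j) = {0})"

definition is_direct_sum ::
  "('a::comm_ring_1 ^ 'n) set \<Rightarrow> 'i set \<Rightarrow> ('i \<Rightarrow> ('a ^ 'n) set) \<Rightarrow> bool" where
  "is_direct_sum S I M \<longleftrightarrow> S = (\<Sum>i\<in>I. M i) \<and> direct_family I M"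

definition scale_set :: "'a::comm_ring_1 \<Rightarrow> ('a ^ 'n) set \<Rightarrow> ('a ^ 'n) set" where
  "scale_set a M = (\<lambda>x. a *s x) ` M"

end

theory Submission
  imports Defs
begin

text \<open>Write \<open>R\<close> for the ring of Laurent series over the integers modulo \<open>p ^ r\<close>. The structure of \<open>R\<close>
  carries the proof: an element that is not a multiple of \<open>p\<close> is a unit, and \<open>p\<close> is nilpotent of
  exponent exactly \<open>r\<close>. Hence \<open>p ^ i * x = 0\<close> holds exactly when \<open>p ^ (r - i)\<close> divides \<open>x\<close>.

  Over such a ring, linear algebra with free submodules works as over a field, because in a linear
  relation one may divide by the highest common power of \<open>p\<close> and reach a unit coefficient. So a
  generating set of a free code contains a basis (\<open>generators_contain_basis\<close>), and an independent
  set extends to a basis of \<open>R ^ n\<close> by Steinitz exchange with unit vectors (\<open>exchange\<close>).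

  Choose a basis of every \<open>C_i\<close>. As the sum of the \<open>C_i\<close> is direct, the union of these bases is
  independent; extend it to a basis \<open>h\<close> of \<open>R ^ n\<close>, and let \<open>h'\<close> be the dual basis. Give a vector
  of \<open>h\<close> the level \<open>i\<close> if it lies in the basis of \<open>C_i\<close>, and the level \<open>r\<close> if it was added. The
  code is then spanned by the vectors \<open>p ^ lev l * h l\<close>, so \<open>y\<close> is orthogonal to it exactly when
  \<open>p ^ lev l\<close> annihilates the coordinate \<open>[y, h l]\<close>, that is, when \<open>p ^ (r - lev l)\<close> divides this
  coordinate. Therefore \<open>B_i\<close>, the span of those \<open>h' l\<close> with \<open>lev l = r - i\<close>, has all the required
  properties (\<open>orthogonal_decomposition\<close>). For \<open>i = 0\<close> these are the \<open>h' l\<close> dual to the added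
  vectors, and for \<open>0 < i\<close> their number is the rank of \<open>C_(r - i)\<close>.

  A convolutional code must have polynomial generators, and a finitely generated submodule of
  \<open>R ^ n\<close> need not have any.
  The argument therefore keeps track of a subring \<open>K\<close> of \<open>R\<close> that contains the inverses of those of
  its elements that are units of \<open>R\<close>. For \<open>K\<close> the ring of rational series, polynomial bases of
  the \<open>C_i\<close> produce an \<open>h'\<close> with entries in \<open>K\<close>, and multiplication by a common denominator, which
  is a unit, makes every vector of \<open>h'\<close> polynomial without a change of the span
  (\<open>convolutional_code_span_rational\<close>).\<close>

(* Only the coordinates of vectors are to be written with the dollar sign. *)
unbundle no Formal_Power_Series.fps_syntax

section \<open>Local rings with a nilpotent uniformizer\<close>

text \<open>These axioms describe the commutative local rings whose maximal ideal is generated by one element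
  \<open>\<pi>\<close> of nilpotency index \<open>r\<close>; the ideals of such a ring are the powers of \<open>(\<pi>)\<close>. For \<open>r = 0\<close>
  the first two axioms contradict each other, since \<open>r - 1\<close> is then \<open>0\<close>.\<close>

locale chain_ring =
  fixes \<pi> :: "'a::comm_ring_1" and r :: nat
  assumes power_r: "\<pi> ^ r = 0"
    and power_pred_r: "\<pi> ^ (r - 1) \<noteq> 0"
    and unitI: "\<not> \<pi> dvd x \<Longrightarrow> x dvd 1"
begin

lemma r_pos: "r > 0"
  using power_r power_pred_r by (cases r) auto

lemma ex_inverse:
  assumes "\<not> \<pi> dvd x"
  shows "\<exists>y. x * y = 1"
proof -
  obtain y where "1 = x * y" using unitI[OF assms] by (rule dvdE)
  then show ?thesis by metis
qed

lemma power_eq_0_iff_ge: "\<pi> ^ i = 0 \<longleftrightarrow> r \<le> i"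
proof
  show "\<pi> ^ i = 0" if "r \<le> i"
    using that power_r by (metis le_add_diff_inverse mult_zero_left power_add)
  show "r \<le> i" if "\<pi> ^ i = 0"
  proof (rule ccontr)
    assume "\<not> r \<le> i"
    then have "\<pi> ^ (r - 1) = \<pi> ^ i * \<pi> ^ (r - 1 - i)"
      by (simp flip: power_add)
    then show False using that power_pred_r by simp
  qed
qed

text \<open>The exponent \<open>s\<close> is the minimum of the \<open>\<pi>\<close>-adic valuations of the family. After division by
  \<open>\<pi> ^ s\<close> some member is a unit, which replaces the division by a nonzero scalar over a field.\<close>

lemma ex_common_valuation:
  assumes "finite S" "v \<in> S" "a v \<noteq> 0"
  shows "\<exists>s<r. \<exists>u. (\<forall>v\<in>S. a v = \<pi> ^ s * u v) \<and> (\<exists>v\<in>S. \<not> \<pi> dvd u v)"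
proof -
  define P where "P s \<longleftrightarrow> (\<forall>v\<in>S. \<pi> ^ s dvd a v)" for s
  have "P 0" by (simp add: P_def)
  have lt: "s < r" if "P s" for s
  proof (rule ccontr)
    assume "\<not> s < r"
    then have "\<pi> ^ s = 0" by (simp add: power_eq_0_iff_ge)
    then have "0 dvd a v" using that \<open>v \<in> S\<close> unfolding P_def by metis
    then show False using \<open>a v \<noteq> 0\<close> by simp
  qed
  have bound: "\<And>s. P s \<Longrightarrow> s \<le> r" using lt by (metis less_imp_le)
  define s where "s = (GREATEST s. P s)"
  have Ps: "P s" unfolding s_def
    by (rule GreatestI_nat[of P 0 r, OF \<open>P 0\<close> bound])
  have nP: "\<not> P (Suc s)"
  proof
    assume "P (Suc s)"
    then have "Suc s \<le> s" unfolding s_def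
      by (rule Greatest_le_nat[of P _ r, OF _ bound])
    then show False by simp
  qed
  from Ps have "\<forall>v\<in>S. \<exists>u. a v = \<pi> ^ s * u" by (auto simp: P_def dvd_def)
  then obtain u where u: "\<And>v. v \<in> S \<Longrightarrow> a v = \<pi> ^ s * u v" by metis
  from nP obtain v' where "v' \<in> S" "\<not> \<pi> ^ Suc s dvd a v'" by (auto simp: P_def)
  then have "\<not> \<pi> dvd u v'" using u[of v'] by (auto simp: mult.commute[of \<pi>] mult_dvd_mono)
  with \<open>v' \<in> S\<close> u lt[OF Ps] show ?thesis by blast
qed

lemma annihilator_power:
  assumes "\<pi> ^ i * x = 0" "i \<le> r"
  shows "\<pi> ^ (r - i) dvd x"
proof (cases "x = 0")
  case False
  then obtain s u where su: "x = \<pi> ^ s * u" "\<not> \<pi> dvd u"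
    using ex_common_valuation[of "{x}" x "\<lambda>x. x"] by auto
  then obtain w where w: "u * w = 1" using ex_inverse[of u] by blast
  have "\<pi> ^ (i + s) = \<pi> ^ i * x * w"
    using w su(1) by (simp add: power_add mult.assoc)
  then have "r \<le> i + s" using assms(1) by (simp add: power_eq_0_iff_ge)
  then have "\<pi> ^ (r - i) dvd \<pi> ^ s" by (intro le_imp_power_dvd) auto
  then show ?thesis using su(1) by simp
qed auto

text \<open>Multiplication by \<open>\<pi> ^ (r - 1)\<close> kills exactly the elements that vanish in the residue field, so that
  statements about the residue field can be made inside the ring.\<close>

lemma dvd_iff_annihilated: "\<pi> dvd x \<longleftrightarrow> \<pi> ^ (r - 1) * x = 0"
proof
  assume "\<pi> dvd x"
  then obtain y where "x = \<pi> * y" by (auto simp: dvd_def)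
  then have "\<pi> ^ (r - 1) * x = \<pi> ^ Suc (r - 1) * y" by (simp add: mult.assoc mult.left_commute)
  then show "\<pi> ^ (r - 1) * x = 0" using r_pos power_r by simp
next
  assume "\<pi> ^ (r - 1) * x = 0"
  then have "\<pi> ^ (r - (r - 1)) dvd x" by (rule annihilator_power) simp
  then show "\<pi> dvd x" using r_pos by simp
qed

section \<open>Bases inside generating sets\<close>

text \<open>This property of a free submodule makes it possible to find a basis among given generators.
  A submodule such as \<open>\<pi> R\<close> violates it when \<open>1 < r\<close>.\<close>

lemma free_submodule_divisible:
  fixes B :: "('a ^ 'n) set"
  assumes B: "cvec.independent B" and x: "x \<in> cvec.span B" and "\<pi> ^ (r - 1) *s x = 0"
  shows "\<exists>y\<in>cvec.span B. x = \<pi> *s y"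
proof -
  from x obtain t a where t: "finite t" "t \<subseteq> B" and xt: "x = (\<Sum>v\<in>t. a v *s v)"
    by (auto simp: cvec.span_explicit)
  have "(\<Sum>v\<in>t. (\<pi> ^ (r - 1) * a v) *s v) = 0"
    using assms(3) xt by (simp add: cvec.scale_sum_right)
  then have "\<pi> ^ (r - 1) * a v = 0" if "v \<in> t" for v
    using cvec.independentD[OF B t _ that, of "\<lambda>v. \<pi> ^ (r - 1) * a v"] by simp
  then have "\<forall>v\<in>t. \<pi> dvd a v" by (metis dvd_iff_annihilated)
  then have "\<forall>v\<in>t. \<exists>b. a v = \<pi> * b" by (simp add: dvd_def)
  then obtain b where b: "\<And>v. v \<in> t \<Longrightarrow> a v = \<pi> * b v" by metis
  have "x = \<pi> *s (\<Sum>v\<in>t. b v *s v)"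
    using xt b by (simp add: cvec.scale_sum_right)
  moreover have "(\<Sum>v\<in>t. b v *s v) \<in> cvec.span B"
    using t by (intro cvec.span_sum cvec.span_scale cvec.span_base) auto
  ultimately show ?thesis by blast
qed

text \<open>A generating subset of minimal cardinality is independent. In a nontrivial relation, divide by the
  common power of \<open>\<pi>\<close>: what remains is a combination \<open>x\<close> with a unit coefficient that is killed by
  \<open>\<pi> ^ (r - 1)\<close>, hence is \<open>\<pi>\<close> times a combination of the same generators. Subtracting the two
  gives a relation that still has a unit coefficient, and the corresponding generator is redundant.\<close>

lemma generators_contain_basis:
  fixes T :: "('a ^ 'n) set"
  assumes T: "finite T"
    and div: "\<And>x. x \<in> cvec.span T \<Longrightarrow> \<pi> ^ (r - 1) *s x = 0 \<Longrightarrow> \<exists>y\<in>cvec.span T. x = \<pi> *s y"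
  obtains S where "S \<subseteq> T" "cvec.independent S" "cvec.span S = cvec.span T"
proof -
  define P where "P S \<longleftrightarrow> S \<subseteq> T \<and> cvec.span S = cvec.span T" for S
  have "P T" by (simp add: P_def)
  then obtain S where S: "P S" and min: "\<And>S'. P S' \<Longrightarrow> card S \<le> card S'"
    by (rule exE[OF ex_has_least_nat[of P T card]]) blast
  have fin: "finite S" using S T by (auto simp: P_def intro: finite_subset)
  have "cvec.independent S"
  proof
    assume "cvec.dependent S"
    then obtain a v where av: "v \<in> S" "a v \<noteq> 0" and rel: "(\<Sum>v\<in>S. a v *s v) = 0"
      using fin by (auto simp: cvec.dependent_finite)
    obtain s u v' where su: "s < r" "\<And>v. v \<in> S \<Longrightarrow> a v = \<pi> ^ s * u v" "v' \<in> S" "\<not> \<pi> dvd u v'"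
      using ex_common_valuation[of S v a, OF fin av] by blast
    define x where "x = (\<Sum>v\<in>S. u v *s v)"
    have sx: "\<pi> ^ s *s x = 0"
      using rel su(2) by (simp add: x_def cvec.scale_sum_right)
    have "\<pi> ^ (r - 1) *s x = \<pi> ^ (r - 1 - s) *s (\<pi> ^ s *s x)"
      using su(1) unfolding cvec.scale_scale power_add[symmetric] by simp
    then have "\<pi> ^ (r - 1) *s x = 0" using sx by simp
    moreover have "x \<in> cvec.span T"
      using S unfolding x_def P_def
      by (intro cvec.span_sum cvec.span_scale cvec.span_base) blast
    ultimately obtain y where "y \<in> cvec.span S" and xy: "x = \<pi> *s y"
      using div S unfolding P_def by auto
    then obtain b where b: "y = (\<Sum>v\<in>S. b v *s v)" by (auto simp: cvec.span_finite[OF fin])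
    define c where "c v = u v - \<pi> * b v" for v
    have c0: "(\<Sum>v\<in>S. c v *s v) = 0"
      using xy b by (simp add: c_def x_def cvec.scale_left_diff_distrib sum_subtractf
          cvec.scale_sum_right)
    have "\<not> \<pi> dvd c v'"
    proof
      assume "\<pi> dvd c v'"
      then have "\<pi> dvd c v' + \<pi> * b v'" by (rule dvd_add) simp
      then show False using su(4) by (simp add: c_def)
    qed
    then obtain d where d: "c v' * d = 1" using ex_inverse[of "c v'"] by blast
    have "v' = (d * c v') *s v'" using d by (simp add: mult.commute)
    also have "\<dots> = d *s (c v' *s v')" by simp
    also have "c v' *s v' = - (\<Sum>v\<in>S - {v'}. c v *s v)"
      using c0 sum.remove[OF fin su(3), of "\<lambda>v. c v *s v"] by (simp add: add_eq_0_iff2)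
    also have "d *s - (\<Sum>v\<in>S - {v'}. c v *s v) \<in> cvec.span (S - {v'})"
      by (intro cvec.span_scale cvec.span_neg cvec.span_sum cvec.span_base) auto
    finally have "v' \<in> cvec.span (S - {v'})" .
    then have "S \<subseteq> cvec.span (S - {v'})" by (auto intro: cvec.span_base)
    then have "cvec.span (S - {v'}) = cvec.span S"
      by (meson Diff_subset cvec.span_mono cvec.span_minimal cvec.subspace_span subset_antisym)
    then have "P (S - {v'})" using S by (auto simp: P_def)
    then have "card S \<le> card (S - {v'})" by (rule min)
    then show False using fin su(3) by (metis card_Diff1_less not_le)
  qed
  then show ?thesis using S that by (auto simp: P_def)
qed

end

section \<open>Steinitz exchange over a subring\<close>

text \<open>The last axiom asks for inverses taken in the ambient ring: an element of \<open>K\<close> that has an inverse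
  there has it in \<open>K\<close>. This makes Steinitz exchange possible with all coefficients in \<open>K\<close>, although
  independence continues to refer to the ambient ring.\<close>

locale chain_ring_with_subring = chain_ring \<pi> r for \<pi> :: "'a::comm_ring_1" and r :: nat +
  fixes K :: "'a set"
  assumes zero_K: "0 \<in> K" and one_K: "1 \<in> K"
    and add_K: "x \<in> K \<Longrightarrow> y \<in> K \<Longrightarrow> x + y \<in> K"
    and mult_K: "x \<in> K \<Longrightarrow> y \<in> K \<Longrightarrow> x * y \<in> K"
    and uminus_K: "x \<in> K \<Longrightarrow> - x \<in> K"
    and inverse_K: "x \<in> K \<Longrightarrow> x * y = 1 \<Longrightarrow> y \<in> K"
begin

definition kspan :: "('a ^ 'n) set \<Rightarrow> ('a ^ 'n) set" where
  "kspan T = {\<Sum>v\<in>T. c v *s v |c. \<forall>v\<in>T. c v \<in> K}"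

lemma kspanE:
  assumes "x \<in> kspan T"
  obtains c where "\<And>v. v \<in> T \<Longrightarrow> c v \<in> K" "x = (\<Sum>v\<in>T. c v *s v)"
  using assms unfolding kspan_def by blast

lemma kspanI: "(\<And>v. v \<in> T \<Longrightarrow> c v \<in> K) \<Longrightarrow> x = (\<Sum>v\<in>T. c v *s v) \<Longrightarrow> x \<in> kspan T"
  unfolding kspan_def by blast

lemma kspan_zero: "0 \<in> kspan T"
  by (rule kspanI[where c = "\<lambda>_. 0"]) (simp_all add: zero_K)

lemma kspan_add:
  assumes "x \<in> kspan T" "y \<in> kspan T"
  shows "x + y \<in> kspan T"
proof -
  from assms(1) obtain c where c: "\<And>v. v \<in> T \<Longrightarrow> c v \<in> K" "x = (\<Sum>v\<in>T. c v *s v)"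
    by (rule kspanE) blast
  from assms(2) obtain d where d: "\<And>v. v \<in> T \<Longrightarrow> d v \<in> K" "y = (\<Sum>v\<in>T. d v *s v)"
    by (rule kspanE) blast
  show ?thesis
    by (rule kspanI[where c = "\<lambda>v. c v + d v"])
      (simp_all add: c d add_K cvec.scale_left_distrib sum.distrib)
qed

lemma kspan_scale:
  assumes "a \<in> K" "x \<in> kspan T"
  shows "a *s x \<in> kspan T"
proof -
  from assms(2) obtain c where c: "\<And>v. v \<in> T \<Longrightarrow> c v \<in> K" "x = (\<Sum>v\<in>T. c v *s v)"
    by (rule kspanE) blast
  show ?thesis
    by (rule kspanI[where c = "\<lambda>v. a * c v"])
      (simp_all add: c assms(1) mult_K cvec.scale_sum_right)
qed

lemma kspan_sum: "(\<And>i. i \<in> I \<Longrightarrow> f i \<in> kspan T) \<Longrightarrow> sum f I \<in> kspan T"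
  by (induction I rule: infinite_finite_induct) (simp_all add: kspan_zero kspan_add)

lemma kspan_base:
  assumes "finite T" "v \<in> T"
  shows "v \<in> kspan T"
proof (rule kspanI)
  show "v = (\<Sum>w\<in>T. (if w = v then 1 else 0) *s w)"
    using assms by (simp add: if_distrib[of "\<lambda>c. c *s _"] cong: if_cong)
qed (simp add: zero_K one_K)

lemma kspan_trans: "x \<in> kspan T \<Longrightarrow> T \<subseteq> kspan T' \<Longrightarrow> x \<in> kspan T'"
  by (elim kspanE) (simp add: kspan_sum kspan_scale subset_iff)

lemma kspan_subset_span: "kspan T \<subseteq> cvec.span T"
proof
  fix x assume "x \<in> kspan T"
  then show "x \<in> cvec.span T"
    by (rule kspanE) (simp add: cvec.span_sum cvec.span_scale cvec.span_base)
qed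

text \<open>Each new vector \<open>x\<close> is written in terms of the current set \<open>T'\<close>. If all its coefficients outside
  \<open>S\<close> were multiples of \<open>\<pi>\<close>, multiplication by \<open>\<pi> ^ (r - 1)\<close> would remove them and leave a
  nontrivial relation between \<open>x\<close> and \<open>S\<close>. So some coefficient outside \<open>S\<close> is a unit, and its vector
  may be traded for \<open>x\<close>.\<close>

lemma exchange:
  fixes S T :: "('a ^ 'n) set"
  assumes "finite S" "finite T" "cvec.independent S" "S \<subseteq> kspan T"
  shows "\<exists>T'. finite T' \<and> card T' = card T \<and> S \<subseteq> T' \<and> T \<subseteq> kspan T'"
  using assms(1,3,4)
proof (induction S rule: finite_induct)
  case empty
  then show ?case using assms(2) by (auto intro: kspan_base)
next
  case (insert x S)
  then obtain T' where T': "finite T'" "card T' = card T" "S \<subseteq> T'" "T \<subseteq> kspan T'"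
    by (auto dest: cvec.independent_mono[OF _ subset_insertI])
  show ?case
  proof (cases "x \<in> T'")
    case True
    then show ?thesis using T' by blast
  next
    case x: False
    have "x \<in> kspan T'" using insert.prems T' by (auto intro: kspan_trans)
    then obtain c where c: "\<And>v. v \<in> T' \<Longrightarrow> c v \<in> K" "x = (\<Sum>v\<in>T'. c v *s v)"
      by (metis kspanE)
    have "\<exists>b\<in>T' - S. \<not> \<pi> dvd c b"
    proof (rule ccontr)
      assume "\<not> ?thesis"
      then have zero: "\<pi> ^ (r - 1) * c b = 0" if "b \<in> T' - S" for b
        using that by (metis dvd_iff_annihilated)
      \<comment> \<open>the coefficients of the relation that expresses \<open>\<pi> ^ (r - 1) *s x\<close> through \<open>S\<close>\<close>
      define e where "e v = (if v = x then \<pi> ^ (r - 1) else - (\<pi> ^ (r - 1) * c v))" for v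
      have "\<pi> ^ (r - 1) *s x = (\<Sum>v\<in>T'. (\<pi> ^ (r - 1) * c v) *s v)"
        using c(2) by (simp add: cvec.scale_sum_right)
      also have "\<dots> = (\<Sum>v\<in>S. (\<pi> ^ (r - 1) * c v) *s v)"
        using T' zero by (intro sum.mono_neutral_right) auto
      finally have "\<pi> ^ (r - 1) *s x = (\<Sum>v\<in>S. (\<pi> ^ (r - 1) * c v) *s v)" .
      moreover have "(\<Sum>v\<in>S. e v *s v) = (\<Sum>v\<in>S. - ((\<pi> ^ (r - 1) * c v) *s v))"
        using insert.hyps by (intro sum.cong) (auto simp: e_def)
      ultimately have "(\<Sum>v\<in>insert x S. e v *s v) = 0"
        using insert.hyps by (simp add: e_def sum_negf)
      then have "e x = 0"
        using insert.hyps insert.prems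
          cvec.independentD[OF insert.prems(1), of "insert x S" e x] by simp
      then show False using power_pred_r by (simp add: e_def)
    qed
    then obtain b where b: "b \<in> T'" "b \<notin> S" "\<not> \<pi> dvd c b" by blast
    then obtain d where d: "c b * d = 1" using ex_inverse by blast
    have dK: "d \<in> K" using c(1) b(1) d by (metis inverse_K)
    define T'' where "T'' = insert x (T' - {b})"
    have fin: "finite T''" using T' by (simp add: T''_def)
    have "x = c b *s b + (\<Sum>v\<in>T' - {b}. c v *s v)"
      using c(2) T'(1) b(1) by (simp add: sum.remove)
    then have "c b *s b = x + (\<Sum>v\<in>T' - {b}. (- c v) *s v)"
      by (simp add: sum_negf algebra_simps)
    then have "b = d *s (x + (\<Sum>v\<in>T' - {b}. (- c v) *s v))"
      using d by (metis cvec.scale_one cvec.scale_scale mult.commute)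
    also have "\<dots> \<in> kspan T''"
      using fin dK c(1) by (intro kspan_scale kspan_add kspan_sum kspan_base uminus_K)
        (auto simp: T''_def)
    finally have "T' \<subseteq> kspan T''" using fin by (auto simp: T''_def intro: kspan_base)
    then have "T \<subseteq> kspan T''" using T'(4) by (blast intro: kspan_trans)
    moreover have "card T'' = card T"
    proof -
      have "card T'' = Suc (card (T' - {b}))" using T'(1) x by (simp add: T''_def)
      also have "\<dots> = card T'" using T'(1) b(1) by (rule card_Suc_Diff1)
      finally show ?thesis using T'(2) by simp
    qed
    moreover have "insert x S \<subseteq> T''" using T'(3) b(2) by (auto simp: T''_def)
    ultimately show ?thesis using fin by blast
  qed
qed

end

context chain_ring
begin

lemma independent_card_le:
  fixes S T :: "('a ^ 'n) set"
  assumes S: "cvec.independent S" and T: "finite T" and sub: "S \<subseteq> cvec.span T"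
  shows "finite S" "card S \<le> card T"
proof -
  interpret full: chain_ring_with_subring \<pi> r UNIV by unfold_locales auto
  have kspan: "full.kspan T = cvec.span T"
    using T by (auto simp: full.kspan_def cvec.span_finite)
  have le: "card S' \<le> card T" if S': "S' \<subseteq> S" "finite S'" for S'
  proof -
    obtain T' where "finite T'" "card T' = card T" "S' \<subseteq> T'"
      using full.exchange[OF S'(2) T cvec.independent_mono[OF S S'(1)]] S'(1) sub kspan
      by blast
    then show ?thesis by (metis card_mono)
  qed
  show "finite S"
  proof (rule ccontr)
    assume "infinite S"
    then obtain S' where "S' \<subseteq> S" "finite S'" "card S' = Suc (card T)"
      by (metis infinite_arbitrarily_large)
    then show False using le[of S'] by simp
  qed
  then show "card S \<le> card T" using le by blast
qed

text \<open>The rank is the cardinality of some basis chosen by \<open>SOME\<close>, which could be infinite as far as its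
  definition tells. Comparison in both directions shows that every basis is as large as \<open>B\<close>.\<close>

lemma free_rank_span:
  fixes B :: "('a ^ 'n) set"
  assumes B: "cvec.independent B" "finite B"
  shows "free_rank (cvec.span B) = card B"
proof -
  define B' where "B' = (SOME B'. cvec.independent B' \<and> cvec.span B' = cvec.span B)"
  have B': "cvec.independent B' \<and> cvec.span B' = cvec.span B"
    unfolding B'_def by (rule someI[of _ B]) (use B in simp)
  then have "B' \<subseteq> cvec.span B" "B \<subseteq> cvec.span B'" by (metis cvec.span_superset)+
  then have "card B' = card B"
    using independent_card_le B B' by (metis order_antisym)
  then show ?thesis by (simp add: free_rank_def B'_def)
qed

end


section \<open>Inner products and direct sums\<close>

definition dot :: "'a::comm_ring_1 ^ 'n \<Rightarrow> 'a ^ 'n \<Rightarrow> 'a" where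
  "dot y x = (\<Sum>i\<in>UNIV. y $ i * x $ i)"

lemma dot_zero_left [simp]: "dot 0 x = 0"
  by (simp add: dot_def)

lemma dot_add_left: "dot (y + z) x = dot y x + dot z x"
  by (simp add: dot_def distrib_right sum.distrib)

lemma dot_scale_left: "dot (a *s y) x = a * dot y x"
  by (simp add: dot_def sum_distrib_left mult.assoc)

lemma dot_commute: "dot y x = dot x y"
  by (simp add: dot_def mult.commute)

lemma dot_zero_right [simp]: "dot y 0 = 0"
  by (simp add: dot_def)

lemma dot_add_right: "dot x (y + z) = dot x y + dot x z"
  by (simp add: dot_def distrib_left sum.distrib)

lemma dot_scale_right: "dot x (a *s y) = a * dot x y"
  by (simp add: dot_commute[of x] dot_scale_left)

lemma dot_sum_left: "dot (\<Sum>i\<in>I. f i) x = (\<Sum>i\<in>I. dot (f i) x)"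
  by (induction I rule: infinite_finite_induct) (simp_all add: dot_add_left)

lemma dot_sum_right: "dot x (\<Sum>i\<in>I. f i) = (\<Sum>i\<in>I. dot x (f i))"
  by (induction I rule: infinite_finite_induct) (simp_all add: dot_add_right)

lemma mem_set_sum:
  assumes "finite I"
  shows "x \<in> (\<Sum>i\<in>I. M i) \<longleftrightarrow> (\<exists>s. x = (\<Sum>i\<in>I. s i) \<and> (\<forall>i\<in>I. s i \<in> M i))"
  unfolding set_sum_alt[OF assms] by blast

lemma set_sum_superset:
  assumes "finite I" "i \<in> I" "\<And>j. j \<in> I \<Longrightarrow> 0 \<in> M j" "x \<in> M i"
  shows "x \<in> (\<Sum>i\<in>I. M i)"
  unfolding mem_set_sum[OF assms(1)]
proof (intro exI conjI ballI)
  show "x = (\<Sum>j\<in>I. if j = i then x else 0)" using assms by simp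
  show "(if j = i then x else 0) \<in> M j" if "j \<in> I" for j using that assms by simp
qed

lemma orthogonal_set_sum:
  assumes "finite I" "\<And>i. i \<in> I \<Longrightarrow> 0 \<in> M i"
  shows "(\<forall>x\<in>(\<Sum>i\<in>I. M i). dot y x = 0) \<longleftrightarrow> (\<forall>i\<in>I. \<forall>x\<in>M i. dot y x = 0)" (is "?L = ?R")
proof
  assume ?L
  then show ?R using set_sum_superset[OF assms(1) _ assms(2)] by meson
next
  assume R: ?R
  show ?L
  proof
    fix x assume "x \<in> (\<Sum>i\<in>I. M i)"
    then obtain s where "x = (\<Sum>i\<in>I. s i)" "\<forall>i\<in>I. s i \<in> M i"
      using mem_set_sum[OF assms(1)] by metis
    then show "dot y x = 0" using R by (simp add: dot_sum_right)
  qed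
qed

lemma orthogonal_scale_span:
  "(\<forall>x\<in>scale_set a (cvec.span B). dot y x = 0) \<longleftrightarrow> (\<forall>v\<in>B. a * dot y v = 0)" (is "?L = ?R")
proof
  assume ?L
  then show ?R by (simp add: scale_set_def dot_scale_right cvec.span_base)
next
  assume ?R
  then have "B \<subseteq> {x. a * dot y x = 0}" by blast
  moreover have "cvec.subspace {x. a * dot y x = 0}"
    by (simp add: cvec.subspace_def dot_add_right dot_scale_right distrib_left mult.left_commute)
  ultimately have "cvec.span B \<subseteq> {x. a * dot y x = 0}" by (rule cvec.span_minimal)
  then show ?L by (auto simp: scale_set_def dot_scale_right)
qed

lemma direct_family_disjoint_bases:
  assumes dir: "direct_family I (\<lambda>i. cvec.span (A i))" and "finite I"
    and indep: "cvec.independent (A i)" and ij: "i \<in> I" "j \<in> I" "i \<noteq> j"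
  shows "A i \<inter> A j = {}"
proof (rule ccontr)
  assume "A i \<inter> A j \<noteq> {}"
  then obtain v where v: "v \<in> A i" "v \<in> A j" by blast
  have "v \<in> (\<Sum>k\<in>I - {i}. cvec.span (A k))"
    using ij v \<open>finite I\<close>
    by (intro set_sum_superset[of _ j]) (simp_all add: cvec.span_zero cvec.span_base)
  then have "v = 0" using dir v ij by (auto simp: direct_family_def dest: cvec.span_base)
  then show False using v indep cvec.dependent_zero by blast
qed

lemma independent_Union_direct:
  assumes dir: "direct_family I (\<lambda>i. cvec.span (A i))" and I: "finite I"
    and fin: "\<And>i. i \<in> I \<Longrightarrow> finite (A i)"
    and indep: "\<And>i. i \<in> I \<Longrightarrow> cvec.independent (A i)"
  shows "cvec.independent (\<Union>i\<in>I. A i)"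
proof
  assume dep: "cvec.dependent (\<Union>i\<in>I. A i)"
  have finU: "finite (\<Union>i\<in>I. A i)" using I fin by blast
  from dep obtain u i v where v: "i \<in> I" "v \<in> A i" "u v \<noteq> 0"
    and rel: "(\<Sum>v\<in>(\<Union>i\<in>I. A i). u v *s v) = 0"
    unfolding cvec.dependent_finite[OF finU] by blast
  define w where "w i = (\<Sum>v\<in>A i. u v *s v)" for i
  have w: "w k \<in> cvec.span (A k)" for k
    unfolding w_def by (intro cvec.span_sum cvec.span_scale cvec.span_base)
  have "\<forall>i\<in>I. \<forall>j\<in>I. i \<noteq> j \<longrightarrow> A i \<inter> A j = {}"
    using direct_family_disjoint_bases[OF dir I] indep by blast
  then have "(\<Sum>i\<in>I. w i) = 0"
    using rel sum.UNION_disjoint[OF I, of A "\<lambda>v. u v *s v"] fin by (simp add: w_def)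
  then have "w i = - (\<Sum>j\<in>I - {i}. w j)"
    using sum.remove[OF I v(1), of w] by (simp add: add_eq_0_iff2)
  also have "\<dots> = (\<Sum>j\<in>I - {i}. - w j)" by (simp add: sum_negf)
  finally have "w i \<in> (\<Sum>j\<in>I - {i}. cvec.span (A j))"
    unfolding mem_set_sum[OF finite_Diff[OF I]] using w cvec.span_neg by blast
  then have "w i = 0" using dir v(1) w by (auto simp: direct_family_def)
  then show False
    using cvec.independentD[OF indep[OF v(1)] fin[OF v(1)], of u v] v by (simp add: w_def)
qed

section \<open>Dual bases\<close>

lemma independent_familyD:
  fixes h :: "'n::finite \<Rightarrow> 'a::comm_ring_1 ^ 'm"
  assumes "inj h" "cvec.independent (range h)" "(\<Sum>l\<in>UNIV. g l *s h l) = 0"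
  shows "g l = 0"
proof -
  have "(\<Sum>v\<in>range h. g (inv_into UNIV h v) *s v) = (\<Sum>l\<in>UNIV. g l *s h l)"
    using assms(1) by (simp add: sum.reindex inv_f_f)
  then have "g (inv_into UNIV h (h l)) = 0"
    using assms by (intro cvec.independentD[OF assms(2), of "range h" "\<lambda>v. g (inv_into UNIV h v)"]) auto
  then show ?thesis using assms(1) by (simp add: inv_f_f)
qed

lemma axis_expansion: "(\<Sum>i\<in>UNIV. (x $ i) *s axis i (1::'a::comm_ring_1)) = x"
  by (simp add: vec_eq_iff axis_def if_distrib[of "\<lambda>c. _ * c"] cong: if_cong)

abbreviation axes :: "('a::comm_ring_1 ^ 'n) set" where
  "axes \<equiv> range (\<lambda>i. axis i 1)"

lemma inj_axis: "inj (\<lambda>i. axis i (1::'a::comm_ring_1))"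
  by (simp add: inj_def axis_eq_axis)

lemma card_axes: "card (axes :: ('a::comm_ring_1 ^ 'n) set) = CARD('n)"
  by (simp add: card_image inj_axis)

lemma span_axes: "cvec.span axes = UNIV"
proof -
  have "x \<in> cvec.span axes" for x :: "'a ^ 'n"
    by (subst axis_expansion[symmetric]) (intro cvec.span_sum cvec.span_scale cvec.span_base rangeI)
  then show ?thesis by blast
qed

lemma independent_axes: "cvec.independent (axes :: ('a::comm_ring_1 ^ 'n) set)"
proof
  assume "cvec.dependent (axes :: ('a ^ 'n) set)"
  then obtain u and i :: 'n where u: "u (axis i 1) \<noteq> 0" "(\<Sum>v\<in>axes. u v *s v) = (0 :: 'a ^ 'n)"
    by (subst (asm) cvec.dependent_finite) auto
  then have "(\<Sum>i\<in>UNIV. u (axis i 1) *s axis i 1) = (0 :: 'a ^ 'n)"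
    by (simp add: sum.reindex inj_axis)
  moreover have "(\<Sum>i\<in>UNIV. u (axis i 1) *s axis i 1) = (\<chi> i. u (axis i 1))"
    using axis_expansion[of "\<chi> i. u (axis i 1)"] by simp
  ultimately show False using u(1) by (simp add: vec_eq_iff)
qed

text \<open>The second axiom states that \<open>h'\<close> generates the whole module, in the form in which this is used:
  the coordinates with respect to \<open>h'\<close> are the inner products with \<open>h\<close>.\<close>

locale dual_bases =
  fixes h h' :: "'n::finite \<Rightarrow> 'a::comm_ring_1 ^ 'n"
  assumes dot_dual: "dot (h' l) (h m) = (if l = m then 1 else 0)"
    and dual_expansion: "y = (\<Sum>l\<in>UNIV. dot y (h l) *s h' l)"
begin

lemma inj_h: "inj h"
  by (rule injI) (metis dot_dual zero_neq_one)

lemma inj_h': "inj h'"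
  by (rule injI) (metis dot_dual zero_neq_one)

lemma eq_0_if_coords_0: "(\<And>l. dot y (h l) = 0) \<Longrightarrow> y = 0"
  by (subst dual_expansion) simp

lemma span_dual_iff: "y \<in> cvec.span (h' ` L) \<longleftrightarrow> (\<forall>l. l \<notin> L \<longrightarrow> dot y (h l) = 0)"
proof
  have "h' ` L \<subseteq> {y. \<forall>l. l \<notin> L \<longrightarrow> dot y (h l) = 0}"
    by (auto simp: dot_dual)
  moreover have "cvec.subspace {y. \<forall>l. l \<notin> L \<longrightarrow> dot y (h l) = 0}"
    by (simp add: cvec.subspace_def dot_add_left dot_scale_left)
  ultimately have "cvec.span (h' ` L) \<subseteq> {y. \<forall>l. l \<notin> L \<longrightarrow> dot y (h l) = 0}"
    by (rule cvec.span_minimal)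
  then show "y \<in> cvec.span (h' ` L) \<Longrightarrow> \<forall>l. l \<notin> L \<longrightarrow> dot y (h l) = 0" by blast
next
  assume y: "\<forall>l. l \<notin> L \<longrightarrow> dot y (h l) = 0"
  have "dot y (h l) *s h' l \<in> cvec.span (h' ` L)" for l
    using y by (cases "l \<in> L") (simp_all add: cvec.span_scale cvec.span_base cvec.span_zero)
  then show "y \<in> cvec.span (h' ` L)"
    by (subst dual_expansion) (intro cvec.span_sum)
qed

lemma independent_dual: "cvec.independent (h' ` L)"
proof
  assume "cvec.dependent (h' ` L)"
  then obtain u l where l: "l \<in> L" "u (h' l) \<noteq> 0" and rel: "(\<Sum>v\<in>h' ` L. u v *s v) = 0"
    by (subst (asm) cvec.dependent_finite) auto
  have "(\<Sum>m\<in>L. u (h' m) *s h' m) = 0"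
    using rel inj_on_subset[OF inj_h' subset_UNIV, of L] by (simp add: sum.reindex)
  then have "0 = dot (\<Sum>m\<in>L. u (h' m) *s h' m) (h l)" by simp
  also have "\<dots> = u (h' l)"
    using l(1) by (simp add: dot_sum_left dot_scale_left dot_dual if_distrib[of "\<lambda>c. _ * c"] cong: if_cong)
  finally show False using l(2) by simp
qed

end

context chain_ring_with_subring
begin

text \<open>Exchange with the unit vectors yields \<open>CARD('n)\<close> vectors \<open>T\<close> whose \<open>K\<close>-span contains all unit
  vectors. Were \<open>T\<close> dependent, a proper subset of it would be a basis, with fewer elements than the
  standard one; so \<open>T\<close> is a basis \<open>h\<close>. The coefficients \<open>X\<close> of the unit vectors in this basis form the
  inverse of the matrix with rows \<open>h l\<close>, and the columns of that inverse are the dual basis. Being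
  coefficients of the exchange process, its entries lie in \<open>K\<close>.\<close>

lemma extend_to_dual_bases:
  fixes S :: "('a ^ 'n) set"
  assumes S: "finite S" "cvec.independent S" "\<And>v i. v \<in> S \<Longrightarrow> v $ i \<in> K"
  obtains h h' :: "'n \<Rightarrow> 'a ^ 'n" where "S \<subseteq> range h" "dual_bases h h'" "\<And>l i. h' l $ i \<in> K"
proof -
  have "S \<subseteq> kspan axes"
  proof
    fix v assume "v \<in> S"
    then show "v \<in> kspan axes"
      by (subst axis_expansion[symmetric]) (intro kspan_sum kspan_scale kspan_base S(3); simp)
  qed
  then obtain T where T: "finite T" "card T = CARD('n)" "S \<subseteq> T" "axes \<subseteq> kspan T"
    using exchange[OF S(1) _ S(2), of axes] by (auto simp: card_axes)
  have "axes \<subseteq> cvec.span T" using T(4) kspan_subset_span by blast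
  then have span_T: "cvec.span T = UNIV"
    using cvec.span_minimal[of axes "cvec.span T"] span_axes by auto
  obtain B where B: "B \<subseteq> T" "cvec.independent B" "cvec.span B = cvec.span T"
  proof (rule generators_contain_basis[OF T(1)])
    fix x :: "'a ^ 'n" assume "\<pi> ^ (r - 1) *s x = 0"
    then show "\<exists>y\<in>cvec.span T. x = \<pi> *s y"
      using free_submodule_divisible[OF independent_axes, of x] span_axes span_T by auto
  qed
  have "card (axes :: ('a ^ 'n) set) \<le> card B"
    using B T(1) span_T by (intro independent_card_le(2) independent_axes) (auto intro: finite_subset)
  then have "B = T" using B(1) T(1,2) by (metis card_axes card_seteq)
  obtain h :: "'n \<Rightarrow> 'a ^ 'n" where h: "bij_betw h UNIV T"
    using finite_same_card_bij[OF finite T(1), of UNIV] T(2) by auto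
  have inj: "inj h" and range: "range h = T" using h by (auto simp: bij_betw_def)
  have "\<exists>X. (\<forall>l. X l \<in> K) \<and> axis i 1 = (\<Sum>l\<in>UNIV. X l *s h l)" for i
  proof -
    have "axis i 1 \<in> kspan T" using T(4) by blast
    then obtain c where c: "\<And>v. v \<in> T \<Longrightarrow> c v \<in> K" "axis i 1 = (\<Sum>v\<in>T. c v *s v)"
      by (rule kspanE) blast
    note c(2)
    also have "(\<Sum>v\<in>T. c v *s v) = (\<Sum>l\<in>UNIV. c (h l) *s h l)"
      by (rule sum.reindex_bij_betw[OF h, symmetric])
    finally have "axis i 1 = (\<Sum>l\<in>UNIV. c (h l) *s h l)" .
    moreover have "c (h l) \<in> K" for l using c(1) range by blast
    ultimately show ?thesis by (intro exI[of _ "\<lambda>l. c (h l)"]) blast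
  qed
  then obtain X where X: "\<And>i l. X i l \<in> K" "\<And>i. axis i 1 = (\<Sum>l\<in>UNIV. X i l *s h l)"
    by metis
  define h' where "h' l = (\<chi> i. X i l)" for l
  have "dot (h' l) (h m) = (if l = m then 1 else 0)" for l m
  proof -
    \<comment> \<open>both sides of the claim are the coefficients of \<open>h m\<close> in the basis \<open>h\<close>\<close>
    have "(\<Sum>l\<in>UNIV. dot (h' l) (h m) *s h l) = (\<Sum>l\<in>UNIV. \<Sum>i\<in>UNIV. (h m $ i) *s (X i l *s h l))"
      by (simp add: dot_def h'_def cvec.scale_sum_left mult.commute)
    also have "\<dots> = (\<Sum>i\<in>UNIV. (h m $ i) *s (\<Sum>l\<in>UNIV. X i l *s h l))"
      unfolding cvec.scale_sum_right by (rule sum.swap)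
    also have "\<dots> = h m" unfolding X(2)[symmetric] by (rule axis_expansion)
    also have "\<dots> = (\<Sum>l\<in>UNIV. (if l = m then 1 else 0) *s h l)"
      by (simp add: if_distrib[of "\<lambda>c. c *s _"] cong: if_cong)
    finally have "(\<Sum>l\<in>UNIV. (dot (h' l) (h m) - (if l = m then 1 else 0)) *s h l) = 0"
      by (simp add: cvec.scale_left_diff_distrib sum_subtractf)
    then have "dot (h' l) (h m) - (if l = m then 1 else 0) = 0"
      using inj range B(2) \<open>B = T\<close>
      by (intro independent_familyD[of h "\<lambda>l. dot (h' l) (h m) - (if l = m then 1 else 0)"]) simp_all
    then show ?thesis by simp
  qed
  moreover have "y = (\<Sum>l\<in>UNIV. dot y (h l) *s h' l)" for y
  proof -
    have "(\<Sum>l\<in>UNIV. dot y (h l) *s h' l) $ i = y $ i" for i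
    proof -
      have "(\<Sum>l\<in>UNIV. dot y (h l) *s h' l) $ i = dot y (\<Sum>l\<in>UNIV. X i l *s h l)"
        by (simp add: h'_def dot_sum_right dot_scale_right mult.commute)
      also have "\<dots> = y $ i"
        by (simp add: X(2)[symmetric] dot_def axis_def if_distrib[of "\<lambda>c. _ * c"] cong: if_cong)
      finally show ?thesis .
    qed
    then show ?thesis by (simp add: vec_eq_iff)
  qed
  ultimately have "dual_bases h h'" by unfold_locales
  moreover have "h' l $ i \<in> K" for l i using X(1) by (simp add: h'_def)
  ultimately show ?thesis using T(3) range that by blast
qed

section \<open>The orthogonal of a graded sum\<close>

text \<open>The orthogonal is computed in coordinates with respect to the dual basis: the condition on the
  coordinate at \<open>l\<close> is annihilation by \<open>\<pi> ^ lev l\<close>, which is the same as divisibility by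
  \<open>\<pi> ^ (r - lev l)\<close>. A level \<open>0\<close> forces the coordinate to vanish, so these \<open>l\<close> contribute to no
  summand, while the level \<open>r\<close> imposes no condition and gives the summand of index \<open>0\<close>.\<close>

theorem orthogonal_decomposition:
  fixes A :: "nat \<Rightarrow> ('a ^ 'n) set"
  assumes fin: "\<And>i. i < r \<Longrightarrow> finite (A i)"
    and indep: "\<And>i. i < r \<Longrightarrow> cvec.independent (A i)"
    and A_K: "\<And>i v j. i < r \<Longrightarrow> v \<in> A i \<Longrightarrow> v $ j \<in> K"
    and dir: "direct_family {..<r} (\<lambda>i. cvec.span (A i))"
  obtains A' :: "nat \<Rightarrow> ('a ^ 'n) set"
  where "\<And>i. finite (A' i)" "\<And>i. cvec.independent (A' i)" "\<And>i v j. v \<in> A' i \<Longrightarrow> v $ j \<in> K"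
    "is_direct_sum {y. \<forall>x\<in>(\<Sum>i<r. scale_set (\<pi> ^ i) (cvec.span (A i))). dot y x = 0} {..<r}
       (\<lambda>i. scale_set (\<pi> ^ i) (cvec.span (A' i)))"
    "cvec.span (A' 0) = {y. \<forall>x\<in>(\<Sum>i<r. cvec.span (A i)). dot y x = 0}"
    "\<And>i. 0 < i \<Longrightarrow> i < r \<Longrightarrow> card (A' i) = card (A (r - i))"
proof -
  have "cvec.independent (\<Union>i<r. A i)"
    using independent_Union_direct[OF dir] fin indep by simp
  moreover have "finite (\<Union>i<r. A i)" using fin by simp
  ultimately obtain h h' :: "'n \<Rightarrow> 'a ^ 'n" where
    range: "(\<Union>i<r. A i) \<subseteq> range h" and dual: "dual_bases h h'" and h'_K: "\<And>l i. h' l $ i \<in> K"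
    using extend_to_dual_bases[of "\<Union>i<r. A i"] A_K by blast
  interpret dual_bases h h' by (rule dual)
  have disj: "A i \<inter> A j = {}" if "i < r" "j < r" "i \<noteq> j" for i j
    using direct_family_disjoint_bases[OF dir, of i j] indep that by simp
  \<comment> \<open>the level of \<open>l\<close>; the value \<open>r\<close> stands for membership in none of the bases\<close>
  have "\<exists>k\<le>r. \<forall>i<r. h l \<in> A i \<longleftrightarrow> k = i" for l
  proof (cases "\<exists>i<r. h l \<in> A i")
    case True
    then obtain i where "i < r" "h l \<in> A i" by blast
    then show ?thesis using disj by (intro exI[of _ i]) (auto simp: disjoint_iff)
  qed (intro exI[of _ r]; auto)
  then obtain lev where lev_le: "\<And>l. lev l \<le> r" and lev: "\<And>l i. i < r \<Longrightarrow> h l \<in> A i \<longleftrightarrow> lev l = i"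
    by metis
  have A_eq: "A i = h ` {l. lev l = i}" if "i < r" for i
    using lev[OF that] range that by auto
  define A' where "A' i = h' ` {l. lev l = r - i}" for i
  define M where "M i = scale_set (\<pi> ^ i) (cvec.span (A' i))" for i
  have zero_scale: "0 \<in> scale_set a (cvec.span B)" for a and B :: "('a ^ 'n) set"
    unfolding scale_set_def by (rule image_eqI[of _ _ 0]) (simp_all add: cvec.span_zero)
  have M_coord: "dot x (h l) = 0" if "x \<in> M i" "lev l \<noteq> r - i" for x i l
  proof -
    from that(1) obtain z where "z \<in> cvec.span (A' i)" "x = \<pi> ^ i *s z"
      unfolding M_def scale_set_def by blast
    then show ?thesis using that(2) by (simp add: A'_def span_dual_iff dot_scale_left)
  qed
  have orth_iff: "(\<forall>x\<in>(\<Sum>i<r. scale_set (\<pi> ^ i) (cvec.span (A i))). dot y x = 0) \<longleftrightarrow>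
      (\<forall>l. \<pi> ^ lev l * dot y (h l) = 0)" for y
  proof -
    have "(\<forall>x\<in>(\<Sum>i<r. scale_set (\<pi> ^ i) (cvec.span (A i))). dot y x = 0) \<longleftrightarrow>
      (\<forall>i\<in>{..<r}. \<forall>l. lev l = i \<longrightarrow> \<pi> ^ i * dot y (h l) = 0)"
      by (simp add: orthogonal_set_sum zero_scale orthogonal_scale_span A_eq)
    also have "\<dots> \<longleftrightarrow> (\<forall>l. \<pi> ^ lev l * dot y (h l) = 0)"
    proof
      assume below: "\<forall>i\<in>{..<r}. \<forall>l. lev l = i \<longrightarrow> \<pi> ^ i * dot y (h l) = 0"
      show "\<forall>l. \<pi> ^ lev l * dot y (h l) = 0"
      proof
        fix l
        show "\<pi> ^ lev l * dot y (h l) = 0"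
          using below lev_le[of l] power_r by (cases "lev l = r") simp_all
      qed
    qed blast
    finally show ?thesis .
  qed
  have sum_iff: "y \<in> (\<Sum>i<r. M i) \<longleftrightarrow> (\<forall>l. \<pi> ^ lev l * dot y (h l) = 0)" for y
  proof
    assume "y \<in> (\<Sum>i<r. M i)"
    then obtain s where s: "y = (\<Sum>i<r. s i)" "\<And>i. i < r \<Longrightarrow> s i \<in> M i"
      unfolding mem_set_sum[OF finite_lessThan] by blast
    have "\<pi> ^ lev l * dot (s i) (h l) = 0" if i: "i < r" for l i
    proof (cases "lev l = r - i")
      case True
      obtain z where "s i = \<pi> ^ i *s z" using s(2)[OF i] unfolding M_def scale_set_def by blast
      then have "\<pi> ^ lev l * dot (s i) (h l) = \<pi> ^ (lev l + i) * dot z (h l)"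
        by (simp add: dot_scale_left power_add mult.assoc)
      then show ?thesis using True i power_r by simp
    next
      case False
      then show ?thesis using M_coord[OF s(2)[OF i] False] by simp
    qed
    then show "\<forall>l. \<pi> ^ lev l * dot y (h l) = 0"
      by (simp add: s(1) dot_sum_left sum_distrib_left)
  next
    assume y: "\<forall>l. \<pi> ^ lev l * dot y (h l) = 0"
    have "\<exists>c. dot y (h l) = \<pi> ^ (r - lev l) * c" for l
      using annihilator_power[OF _ lev_le, of l "dot y (h l)"] y by (metis dvdE)
    then obtain c where c: "\<And>l. dot y (h l) = \<pi> ^ (r - lev l) * c l" by metis
    define s where "s i = \<pi> ^ i *s (\<Sum>l | lev l = r - i. c l *s h' l)" for i
    have "(\<Sum>l | lev l = r - i. c l *s h' l) \<in> cvec.span (A' i)" for i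
      unfolding A'_def by (intro cvec.span_sum cvec.span_scale cvec.span_base) blast
    then have sM: "s i \<in> M i" for i unfolding s_def M_def scale_set_def by blast
    have "y = (\<Sum>l\<in>UNIV. dot y (h l) *s h' l)" by (rule dual_expansion)
    also have "\<dots> = (\<Sum>l | 0 < lev l. dot y (h l) *s h' l)"
    proof (rule sum.mono_neutral_right)
      show "\<forall>l\<in>UNIV - {l. 0 < lev l}. dot y (h l) *s h' l = 0"
        using power_r by (simp add: c)
    qed auto
    also have "\<dots> = (\<Sum>i<r. \<Sum>l | l \<in> {l. 0 < lev l} \<and> r - lev l = i. dot y (h l) *s h' l)"
      using r_pos by (intro sum.group[symmetric]) auto
    also have "\<dots> = (\<Sum>i<r. s i)"
    proof (rule sum.cong[OF refl])
      fix i assume "i \<in> {..<r}"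
      then have eq: "{l. l \<in> {l. 0 < lev l} \<and> r - lev l = i} = {l. lev l = r - i}"
        using lev_le by (auto simp: Suc_leI)
      have "dot y (h l) *s h' l = \<pi> ^ i *s (c l *s h' l)" if "lev l = r - i" for l
        using that \<open>i \<in> {..<r}\<close> by (simp add: c)
      then show "(\<Sum>l | l \<in> {l. 0 < lev l} \<and> r - lev l = i. dot y (h l) *s h' l) = s i"
        unfolding eq s_def cvec.scale_sum_right by (intro sum.cong) simp_all
    qed
    finally show "y \<in> (\<Sum>i<r. M i)"
      unfolding mem_set_sum[OF finite_lessThan] using sM by blast
  qed
  have "direct_family {..<r} M"
    unfolding direct_family_def
  proof (intro ballI equalityI subsetI)
    fix i x assume i: "i \<in> {..<r}" and x: "x \<in> M i \<inter> (\<Sum>j\<in>{..<r} - {i}. M j)"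
    then obtain s where s: "x = (\<Sum>j\<in>{..<r} - {i}. s j)" "\<And>j. j \<in> {..<r} - {i} \<Longrightarrow> s j \<in> M j"
      using mem_set_sum[of "{..<r} - {i}" x M] by auto
    have "dot x (h l) = 0" for l
    proof (cases "lev l = r - i")
      case True
      have "dot (s j) (h l) = 0" if "j \<in> {..<r} - {i}" for j
        using M_coord[OF s(2)[OF that]] True that i by auto
      then show ?thesis by (simp add: s(1) dot_sum_left)
    qed (use M_coord x in blast)
    then show "x \<in> {0}" using eq_0_if_coords_0 by blast
  next
    fix i x assume "x \<in> {0 :: 'a ^ 'n}"
    moreover have "(0 :: 'a ^ 'n) \<in> (\<Sum>j\<in>{..<r} - {i}. M j)"
      unfolding mem_set_sum[OF finite_Diff[OF finite_lessThan]]
      by (intro exI[of _ "\<lambda>_. 0"]) (simp add: M_def zero_scale)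
    ultimately show "x \<in> M i \<inter> (\<Sum>j\<in>{..<r} - {i}. M j)" by (simp add: M_def zero_scale)
  qed
  then have direct_sum:
    "is_direct_sum {y. \<forall>x\<in>(\<Sum>i<r. scale_set (\<pi> ^ i) (cvec.span (A i))). dot y x = 0} {..<r} M"
    unfolding is_direct_sum_def using orth_iff sum_iff by blast
  have "y \<in> cvec.span (A' 0) \<longleftrightarrow> (\<forall>x\<in>(\<Sum>i<r. cvec.span (A i)). dot y x = 0)" for y
  proof -
    have scale1: "scale_set 1 N = N" for N :: "('a ^ 'n) set" by (simp add: scale_set_def)
    have "(\<forall>x\<in>(\<Sum>i<r. cvec.span (A i)). dot y x = 0) \<longleftrightarrow> (\<forall>i\<in>{..<r}. \<forall>v\<in>A i. dot y v = 0)"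
      using orthogonal_scale_span[of 1 _ y]
      by (simp add: orthogonal_set_sum cvec.span_zero scale1)
    also have "\<dots> \<longleftrightarrow> (\<forall>l. lev l \<noteq> r \<longrightarrow> dot y (h l) = 0)"
      using lev_le by (auto simp: A_eq le_neq_implies_less)
    finally show ?thesis by (simp add: A'_def span_dual_iff)
  qed
  then have "cvec.span (A' 0) = {y. \<forall>x\<in>(\<Sum>i<r. cvec.span (A i)). dot y x = 0}" by blast
  moreover have "card (A' i) = card (A (r - i))" if "0 < i" "i < r" for i
    using that inj_on_subset[OF inj_h] inj_on_subset[OF inj_h']
    by (simp add: A'_def A_eq card_image)
  moreover have "finite (A' i)" "cvec.independent (A' i)" for i
    by (simp_all add: A'_def independent_dual)
  moreover have "v $ j \<in> K" if "v \<in> A' i" for i j and v :: "'a ^ 'n"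
    using that h'_K by (auto simp: A'_def)
  ultimately show ?thesis using direct_sum that[of A'] unfolding M_def by blast
qed

end

section \<open>Laurent series over a chain ring\<close>

context
  includes Formal_Laurent_Series.fps_syntax
begin

lemma fls_const_power: "fls_const (c :: 'a::comm_ring_1) ^ k = fls_const (c ^ k)"
  by (induction k) simp_all

text \<open>A Laurent series with a unit as first coefficient is a shift of a power series with an invertible
  constant term.\<close>

lemma fls_unit_if_leading_coeff_unit:
  fixes w :: "'a::comm_ring_1 fls"
  assumes below: "\<And>n. n < m \<Longrightarrow> w $$ n = 0" and unit: "w $$ m dvd 1"
  shows "w dvd 1"
proof -
  obtain y where "1 = w $$ m * y" using unit by (rule dvdE)
  define f where "f = Abs_fps (\<lambda>k. w $$ (m + int k))"
  have w: "w = fls_shift (- m) (fps_to_fls f)"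
    by (rule fls_eqI) (use below in \<open>simp add: f_def\<close>)
  have "fps_nth f 0 * y = 1" using \<open>1 = w $$ m * y\<close> by (simp add: f_def)
  then have "f * fps_right_inverse f y = 1" by (rule fps_right_inverse)
  then have "w * fls_shift m (fps_to_fls (fps_right_inverse f y)) = 1"
    unfolding w fls_times_both_shifted_simp by (simp flip: fls_times_fps_to_fls)
  then show ?thesis by (metis dvdI)
qed

lemma one_plus_nilpotent_unit:
  fixes y :: "'a::comm_ring_1"
  assumes "y ^ k = 0"
  shows "1 + y dvd 1"
proof -
  have "(- y) ^ k = 0" using assms by (metis minus_one_power_iff mult_zero_right power_minus)
  then have "1 = (1 + y) * (\<Sum>i<k. (- y) ^ i)"
    using one_diff_power_eq[of "- y" k] by simp
  then show ?thesis by (rule dvdI)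
qed

text \<open>If \<open>\<pi>\<close> does not divide \<open>x\<close>, it fails to divide some coefficient of \<open>x\<close>; let \<open>m\<close> be the least index
  at which this happens. The part of \<open>x\<close> below \<open>m\<close> is a multiple of \<open>\<pi>\<close>, hence nilpotent, and the
  rest \<open>w\<close> starts with a unit, hence is a unit. A unit plus a nilpotent element is a unit.\<close>

lemma chain_ring_fls:
  fixes \<pi> :: "'a::comm_ring_1"
  assumes "chain_ring \<pi> r"
  shows "chain_ring (fls_const \<pi>) r"
proof -
  interpret chain_ring \<pi> r by (rule assms)
  have unit: "x dvd 1" if nd: "\<not> fls_const \<pi> dvd x" for x :: "'a fls"
  proof -
    define N where "N = fls_subdegree x"
    have low: "x $$ n = 0" if "n < N" for n using that by (simp add: N_def)
    \<comment> \<open>quotients are chosen as \<open>0\<close> below the subdegree \<open>N\<close>, so that they form a Laurent series\<close>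
    have lower_part: "\<exists>z. \<forall>n. (fls_const \<pi> * z) $$ n = (if P n then x $$ n else 0)"
      if "\<And>n. P n \<Longrightarrow> \<pi> dvd x $$ n" for P
    proof -
      have "\<exists>b. P n \<and> N \<le> n \<longrightarrow> x $$ n = \<pi> * b" for n
        using that[of n] by (metis dvdE)
      then obtain b where b: "\<And>n. P n \<Longrightarrow> N \<le> n \<Longrightarrow> x $$ n = \<pi> * b n" by metis
      define z where "z = Abs_fls (\<lambda>n. if P n \<and> N \<le> n then b n else 0)"
      have z: "z $$ n = (if P n \<and> N \<le> n then b n else 0)" for n
        unfolding z_def by (rule nth_Abs_fls_lower_bound[of N]) simp
      have "(fls_const \<pi> * z) $$ n = (if P n then x $$ n else 0)" for n
        using b[of n] low[of n] by (simp add: z not_le)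
      then show ?thesis by blast
    qed
    have "\<exists>n. \<not> \<pi> dvd x $$ n"
    proof (rule ccontr)
      assume "\<nexists>n. \<not> \<pi> dvd x $$ n"
      then obtain z where z: "\<And>n. (fls_const \<pi> * z) $$ n = x $$ n"
        using lower_part[of "\<lambda>_. True"] by auto
      have "x = fls_const \<pi> * z" by (rule fls_eqI) (use z in simp)
      then show False using nd by (metis dvdI)
    qed
    then obtain n0 where n0: "\<not> \<pi> dvd x $$ n0" by blast
    then have "N \<le> n0" using low[of n0] by (metis dvd_0_right not_le)
    define k where "k = (LEAST k. \<not> \<pi> dvd x $$ (N + int k))"
    define m where "m = N + int k"
    have "\<not> \<pi> dvd x $$ (N + int (nat (n0 - N)))" using n0 \<open>N \<le> n0\<close> by simp
    then have m: "\<not> \<pi> dvd x $$ m" unfolding m_def k_def by (rule LeastI)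
    have below: "\<pi> dvd x $$ n" if "n < m" for n
    proof (cases "N \<le> n")
      case True
      then have "nat (n - N) < k" using that by (simp add: m_def)
      then have "\<pi> dvd x $$ (N + int (nat (n - N)))" unfolding k_def using not_less_Least by blast
      then show ?thesis using True by simp
    qed (simp add: low)
    obtain z where z: "\<And>n. (fls_const \<pi> * z) $$ n = (if n < m then x $$ n else 0)"
      using lower_part[of "\<lambda>n. n < m"] below by blast
    define w where "w = x - fls_const \<pi> * z"
    have w_nth: "w $$ n = (if n < m then 0 else x $$ n)" for n
      using z[of n] by (simp add: w_def)
    have "w dvd 1"
      using unitI[OF m] by (intro fls_unit_if_leading_coeff_unit[of m]) (simp_all add: w_nth)
    then obtain v where v: "1 = w * v" by (rule dvdE)
    have "(fls_const \<pi> * (z * v)) ^ r = 0"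
      unfolding power_mult_distrib fls_const_power power_r by simp
    then have "1 + fls_const \<pi> * (z * v) dvd 1" by (rule one_plus_nilpotent_unit)
    moreover have "x * v = 1 + fls_const \<pi> * (z * v)"
      unfolding v by (simp add: w_def algebra_simps)
    ultimately show "x dvd 1" by (metis dvd_mult_left)
  qed
  show ?thesis
  proof
    show "fls_const \<pi> ^ r = 0" by (simp only: fls_const_power power_r fls_const_0)
    show "fls_const \<pi> ^ (r - 1) \<noteq> 0"
      unfolding fls_const_power by (rule fls_const_nonzero[OF power_pred_r])
  qed (rule unit)
qed

end

lemma chain_ring_mod_prime_power:
  assumes "Factorial_Ring.prime p" "r > 0" "CARD('a::nontriv) = p ^ r"
  shows "chain_ring (of_nat p :: 'a mod_ring) r"
proof
  show "(of_nat p :: 'a mod_ring) ^ r = 0"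
    using of_nat_card_eq_0[where 'a = 'a] assms(3) by simp
  show "(of_nat p :: 'a mod_ring) ^ (r - 1) \<noteq> 0"
  proof
    assume "(of_nat p :: 'a mod_ring) ^ (r - 1) = 0"
    then have "of_int_mod_ring (int (p ^ (r - 1))) = (0 :: 'a mod_ring)"
      by (metis of_nat_of_int_mod_ring o_apply of_nat_power)
    moreover have "int (p ^ (r - 1)) < int CARD('a)"
      using assms prime_gt_1_nat[OF assms(1)] by (simp add: power_strict_increasing)
    ultimately have "int (p ^ (r - 1)) = 0"
      by (metis of_nat_0_le_iff to_int_mod_ring_hom.hom_zero to_int_mod_ring_of_int_mod_ring)
    then show False using prime_gt_0_nat[OF assms(1)] by simp
  qed
  fix x :: "'a mod_ring"
  define z where "z = to_int_mod_ring x"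
  have x: "x = of_int z" by (simp add: z_def of_int_of_int_mod_ring)
  assume nd: "\<not> of_nat p dvd x"
  have "\<not> int p dvd z"
  proof
    assume "int p dvd z"
    then obtain c where "z = int p * c" by (rule dvdE)
    then have "x = of_nat p * of_int c" by (simp add: x)
    then show False using nd by (metis dvdI)
  qed
  then have "coprime (int p) z" using assms(1) by (simp add: prime_imp_coprime)
  then have "coprime z (int p ^ r)" by (simp add: coprime_commute)
  then obtain u v where "u * z + v * int p ^ r = 1"
    by (metis bezout_int coprime_imp_gcd_eq_1)
  then have "of_int (u * z + v * int p ^ r) = (1 :: 'a mod_ring)" by simp
  moreover have "(of_nat p :: 'a mod_ring) ^ r = 0"
    using of_nat_card_eq_0[where 'a = 'a] assms(3) by simp
  ultimately have "1 = x * of_int u" by (simp add: x mult.commute)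
  then show "x dvd 1" by (rule dvdI)
qed

section \<open>Rational Laurent series\<close>

lemma poly_to_fls_0 [simp]: "poly_to_fls 0 = 0"
  and poly_to_fls_1 [simp]: "poly_to_fls 1 = 1"
  and poly_to_fls_add: "poly_to_fls (f + g) = poly_to_fls f + poly_to_fls g"
  and poly_to_fls_uminus: "poly_to_fls (- f) = - poly_to_fls f"
  and poly_to_fls_mult: "poly_to_fls (f * g) = poly_to_fls f * poly_to_fls g"
  by (simp_all add: poly_to_fls_def fps_of_poly_add fps_of_poly_uminus fps_of_poly_mult
      fls_times_fps_to_fls)

lemma poly_to_fls_prod: "poly_to_fls (\<Prod>i\<in>I. f i) = (\<Prod>i\<in>I. poly_to_fls (f i))"
  by (induction I rule: infinite_finite_induct) (simp_all add: poly_to_fls_mult)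

text \<open>The localization of the polynomial ring at those polynomials that are invertible as Laurent series.
  Over the integers modulo \<open>p ^ r\<close> these are the polynomials not divisible by \<open>p\<close>.\<close>

definition rational_fls :: "'a::comm_ring_1 fls set" where
  "rational_fls = {x. \<exists>q a. poly_to_fls q dvd 1 \<and> poly_to_fls q * x = poly_to_fls a}"

lemma rational_flsI: "poly_to_fls q dvd 1 \<Longrightarrow> poly_to_fls q * x = poly_to_fls a \<Longrightarrow> x \<in> rational_fls"
  unfolding rational_fls_def by blast

lemma rational_flsE:
  assumes "x \<in> rational_fls"
  obtains q a where "poly_to_fls q dvd 1" "poly_to_fls q * x = poly_to_fls a"
  using assms unfolding rational_fls_def by blast

lemma poly_rational: "poly_to_fls a \<in> rational_fls"
  by (rule rational_flsI[of 1 _ a]) simp_all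

text \<open>For closure under inverses: if \<open>x = a / q\<close> is a unit, then so is the polynomial \<open>a = q * x\<close>, and
  therefore \<open>q / a\<close> is again a legitimate fraction.\<close>

lemma chain_ring_with_rational_subring:
  assumes "chain_ring \<pi> r"
  shows "chain_ring_with_subring \<pi> r rational_fls"
proof -
  interpret chain_ring \<pi> r by (rule assms)
  have unit_mult: "a * b dvd 1" if "a dvd 1" "b dvd 1" for a b :: "'a fls"
    using mult_dvd_mono[OF that] by simp
  show ?thesis
  proof
    show "0 \<in> rational_fls" "1 \<in> rational_fls"
      using poly_rational[of 0] poly_rational[of 1] by simp_all
  next
    fix x y :: "'a fls" assume "x \<in> rational_fls" "y \<in> rational_fls"
    then obtain q a q' a' where q: "poly_to_fls q dvd 1" "poly_to_fls q * x = poly_to_fls a"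
      and q': "poly_to_fls q' dvd 1" "poly_to_fls q' * y = poly_to_fls a'"
      by (metis rational_flsE)
    have unit: "poly_to_fls (q * q') dvd 1" using unit_mult q q' by (simp add: poly_to_fls_mult)
    have "poly_to_fls (q * q') * (x + y)
      = poly_to_fls q' * (poly_to_fls q * x) + poly_to_fls q * (poly_to_fls q' * y)"
      by (simp add: poly_to_fls_mult algebra_simps)
    then have "poly_to_fls (q * q') * (x + y) = poly_to_fls (q' * a + q * a')"
      by (simp add: q q' poly_to_fls_mult poly_to_fls_add)
    with unit show "x + y \<in> rational_fls" by (rule rational_flsI)
    have "poly_to_fls (q * q') * (x * y) = (poly_to_fls q * x) * (poly_to_fls q' * y)"
      by (simp add: poly_to_fls_mult algebra_simps)
    then have "poly_to_fls (q * q') * (x * y) = poly_to_fls (a * a')"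
      by (simp add: q q' poly_to_fls_mult)
    with unit show "x * y \<in> rational_fls" by (rule rational_flsI)
  next
    fix x :: "'a fls" assume "x \<in> rational_fls"
    then obtain q a where q: "poly_to_fls q dvd 1" "poly_to_fls q * x = poly_to_fls a"
      by (rule rational_flsE)
    then have "poly_to_fls q * - x = poly_to_fls (- a)" by (simp add: poly_to_fls_uminus)
    with q(1) show "- x \<in> rational_fls" by (rule rational_flsI)
  next
    fix x y :: "'a fls" assume "x \<in> rational_fls" and xy: "x * y = 1"
    then obtain q a where q: "poly_to_fls q dvd 1" "poly_to_fls q * x = poly_to_fls a"
      by (metis rational_flsE)
    have "x dvd 1" using xy by (metis dvdI)
    then have "poly_to_fls a dvd 1" using unit_mult[OF q(1)] q(2) by metis
    moreover have "poly_to_fls a * y = poly_to_fls q"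
      using q(2) xy by (metis mult.assoc mult.right_neutral)
    ultimately show "y \<in> rational_fls" by (rule rational_flsI)
  qed
qed

lemma rational_vec_common_denominator:
  fixes v :: "'a::comm_ring_1 fls ^ 'n"
  assumes "\<And>j. v $ j \<in> rational_fls"
  shows "\<exists>q g. poly_to_fls q dvd 1 \<and> (\<forall>j. poly_to_fls q * v $ j = poly_to_fls (g j))"
proof -
  have "\<forall>j. \<exists>q a. poly_to_fls q dvd 1 \<and> poly_to_fls q * v $ j = poly_to_fls a"
    using assms by (metis rational_flsE)
  then obtain q a where q: "\<And>j. poly_to_fls (q j) dvd 1" "\<And>j. poly_to_fls (q j) * v $ j = poly_to_fls (a j)"
    by metis
  have "(\<Prod>j\<in>UNIV. poly_to_fls (q j)) dvd (\<Prod>j\<in>(UNIV :: 'n set). 1)"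
    by (rule prod_dvd_prod) (rule q(1))
  then have unit: "poly_to_fls (\<Prod>j\<in>UNIV. q j) dvd 1" by (simp add: poly_to_fls_prod)
  have "poly_to_fls (\<Prod>j\<in>UNIV. q j) * v $ j = poly_to_fls ((\<Prod>k\<in>UNIV - {j}. q k) * a j)" for j
  proof -
    have "(\<Prod>j\<in>UNIV. q j) = (\<Prod>k\<in>UNIV - {j}. q k) * q j"
      using prod.remove[of UNIV j q] by (simp add: mult.commute)
    then show ?thesis by (simp add: poly_to_fls_mult mult.assoc q(2))
  qed
  then show ?thesis using unit
    by (intro exI[of _ "\<Prod>j\<in>UNIV. q j"] exI[of _ "\<lambda>j. (\<Prod>k\<in>UNIV - {j}. q k) * a j"]) simp
qed

section \<open>Generators of convolutional codes\<close>

text \<open>Clearing the denominators multiplies every generator by a unit of the Laurent series ring, so the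
  span is unchanged.\<close>

lemma convolutional_code_span_rational:
  fixes V :: "('a::comm_ring_1 fls ^ 'n) set"
  assumes V: "finite V" and rat: "\<And>v j. v \<in> V \<Longrightarrow> v $ j \<in> rational_fls"
  shows "convolutional_code (cvec.span V)"
proof -
  obtain e where e: "bij_betw e {..<card V} V"
    using ex_bij_betw_nat_finite[OF V] by (auto simp: atLeast0LessThan)
  have eV: "e i \<in> V" if "i < card V" for i
    using e that by (auto simp: bij_betw_def)
  have "\<forall>i. \<exists>q g. i < card V \<longrightarrow>
      poly_to_fls q dvd 1 \<and> (\<forall>j. poly_to_fls q * e i $ j = poly_to_fls (g j))"
    using rational_vec_common_denominator rat eV by metis
  then obtain q G where q: "\<And>i. i < card V \<Longrightarrow> poly_to_fls (q i) dvd 1"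
    and G: "\<And>i j. i < card V \<Longrightarrow> poly_to_fls (q i) * e i $ j = poly_to_fls (G i j)"
    by metis
  have "\<forall>i. \<exists>d. i < card V \<longrightarrow> 1 = poly_to_fls (q i) * d" using q by (metis dvdE)
  then obtain d where d: "\<And>i. i < card V \<Longrightarrow> 1 = poly_to_fls (q i) * d i" by metis
  have gen: "(\<chi> j. \<Sum>i<card V. u i * poly_to_fls (G i j)) =
      (\<Sum>i<card V. (u i * poly_to_fls (q i)) *s e i)" for u
    by (simp add: vec_eq_iff mult.assoc G)
  have "cvec.span V = range (\<lambda>u. \<chi> j. \<Sum>i<card V. u i * poly_to_fls (G i j))"
  proof (intro equalityI subsetI)
    fix x assume "x \<in> cvec.span V"
    then obtain c where "x = (\<Sum>v\<in>V. c v *s v)" by (auto simp: cvec.span_finite[OF V])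
    also have "\<dots> = (\<Sum>i<card V. c (e i) *s e i)"
      by (rule sum.reindex_bij_betw[OF e, symmetric])
    also have "\<dots> = (\<Sum>i<card V. (c (e i) * d i * poly_to_fls (q i)) *s e i)"
    proof (rule sum.cong[OF refl])
      fix i assume "i \<in> {..<card V}"
      then have "poly_to_fls (q i) * d i = 1" using d[of i] by simp
      then have "c (e i) * d i * poly_to_fls (q i) = c (e i)"
        by (metis mult.assoc mult.commute mult.right_neutral)
      then show "c (e i) *s e i = (c (e i) * d i * poly_to_fls (q i)) *s e i" by simp
    qed
    finally have "x = (\<Sum>i<card V. (c (e i) * d i * poly_to_fls (q i)) *s e i)" .
    then show "x \<in> range (\<lambda>u. \<chi> j. \<Sum>i<card V. u i * poly_to_fls (G i j))"
      unfolding gen by (intro image_eqI[of _ _ "\<lambda>i. c (e i) * d i"]) simp_all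
  next
    fix x assume "x \<in> range (\<lambda>u. \<chi> j. \<Sum>i<card V. u i * poly_to_fls (G i j))"
    then obtain u where "x = (\<Sum>i<card V. (u i * poly_to_fls (q i)) *s e i)" unfolding gen by blast
    then show "x \<in> cvec.span V"
      using eV by (auto intro: cvec.span_sum cvec.span_scale cvec.span_base)
  qed
  then show ?thesis
    unfolding convolutional_code_def by (intro conjI exI[of _ "card V"] exI[of _ G] cvec.subspace_span)
qed

lemma convolutional_code_generators:
  fixes C :: "('a::comm_ring_1 fls ^ 'n) set"
  assumes "convolutional_code C"
  shows "\<exists>T. finite T \<and> cvec.span T = C \<and> (\<forall>v\<in>T. \<forall>j. v $ j \<in> rational_fls)"
proof -
  from assms obtain k :: nat and G :: "nat \<Rightarrow> 'n \<Rightarrow> 'a poly" where sub: "cvec.subspace C"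
    and C: "C = range (\<lambda>u. \<chi> j. \<Sum>i<k. u i * poly_to_fls (G i j))"
    unfolding convolutional_code_def by blast
  define g where "g i = (\<chi> j. poly_to_fls (G i j))" for i
  have C': "C = range (\<lambda>u. \<Sum>i<k. u i *s g i)"
    unfolding C by (rule arg_cong[of _ _ range]) (simp add: fun_eq_iff vec_eq_iff g_def)
  have "g i \<in> C" if "i < k" for i
    unfolding C'
  proof (rule image_eqI)
    show "g i = (\<Sum>l<k. (if l = i then 1 else 0) *s g l)"
      using that by (simp add: if_distrib[of "\<lambda>c. c *s _"] cong: if_cong)
  qed simp
  then have "cvec.span (g ` {..<k}) \<subseteq> C" using sub by (intro cvec.span_minimal) auto
  moreover have "C \<subseteq> cvec.span (g ` {..<k})"
    unfolding C' by (intro image_subsetI cvec.span_sum cvec.span_scale cvec.span_base) simp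
  moreover have "\<forall>v\<in>g ` {..<k}. \<forall>j. v $ j \<in> rational_fls"
    by (simp add: g_def poly_rational)
  ultimately show ?thesis by (intro exI[of _ "g ` {..<k}"]) simp
qed

text \<open>A basis is found among the polynomial generators of the code. An arbitrary basis of the free
  module would not do, because its entries need not be rational.\<close>

lemma free_convolutional_code_basis:
  fixes \<pi> :: "'a::comm_ring_1 fls" and C :: "('a fls ^ 'n) set"
  assumes "chain_ring \<pi> r" "free_convolutional_code C"
  shows "\<exists>A. finite A \<and> cvec.independent A \<and> cvec.span A = C \<and> (\<forall>v\<in>A. \<forall>j. v $ j \<in> rational_fls)"
proof -
  interpret chain_ring \<pi> r by (rule assms(1))
  obtain T where T: "finite T" "cvec.span T = C" "\<forall>v\<in>T. \<forall>j. v $ j \<in> rational_fls"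
    using convolutional_code_generators assms(2) unfolding free_convolutional_code_def by metis
  obtain B where B: "cvec.independent B" "cvec.span B = C"
    using assms(2) unfolding free_convolutional_code_def free_submodule_def by blast
  have "\<exists>y\<in>cvec.span T. x = \<pi> *s y" if "x \<in> cvec.span T" "\<pi> ^ (r - 1) *s x = 0" for x
    using free_submodule_divisible[OF B(1), of x] that unfolding B(2) T(2) by blast
  then obtain A where A: "A \<subseteq> T" "cvec.independent A" "cvec.span A = cvec.span T"
    using generators_contain_basis[OF T(1)] by blast
  have "finite A" using A(1) T(1) by (rule finite_subset)
  moreover have "\<forall>v\<in>A. \<forall>j. v $ j \<in> rational_fls" using A(1) T(3) by blast
  ultimately show ?thesis using A(2,3) T(2) by blast
qed

section \<open>The dual of a convolutional code\<close>

theorem theorem2: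
  fixes p r :: nat
    and C :: "('a::nontriv mod_ring fls ^ 'n) set"
    and Cs :: "nat \<Rightarrow> ('a mod_ring fls ^ 'n) set"
  assumes "Factorial_Ring.prime p" and "r > 1" and "CARD('a) = p ^ r"
    and "convolutional_code C"
    and "\<And>i. i < r \<Longrightarrow> free_convolutional_code (Cs i)"
    and "is_direct_sum C {..<r} (\<lambda>i. scale_set (of_nat p ^ i) (Cs i))"
    and "direct_family {..<r} Cs"
    and "free_convolutional_code (\<Sum>i<r. Cs i)"
  shows "\<exists>B :: nat \<Rightarrow> ('a mod_ring fls ^ 'n) set.
           (\<forall>i<r. free_convolutional_code (B i)) \<and>
           is_direct_sum (dual_code C) {..<r} (\<lambda>i. scale_set (of_nat p ^ i) (B i)) \<and>
           B 0 = dual_code (\<Sum>i<r. Cs i) \<and>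
           (\<forall>i\<in>{1..r - 1}. free_rank (B i) = free_rank (Cs (r - i)))"
proof -
  have chain: "chain_ring (of_nat p :: 'a mod_ring fls) r"
    using chain_ring_fls[OF chain_ring_mod_prime_power[OF assms(1) _ assms(3)]] assms(2)
    by (simp add: fls_of_nat)
  interpret chain_ring_with_subring "of_nat p :: 'a mod_ring fls" r rational_fls
    by (rule chain_ring_with_rational_subring[OF chain])
  have "\<forall>i. \<exists>A. i < r \<longrightarrow> finite A \<and> cvec.independent A \<and> cvec.span A = Cs i \<and>
      (\<forall>v\<in>A. \<forall>j. v $ j \<in> rational_fls)"
    using free_convolutional_code_basis[OF chain] assms(5) by metis
  then obtain A where A: "\<And>i. i < r \<Longrightarrow> finite (A i)" "\<And>i. i < r \<Longrightarrow> cvec.independent (A i)"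
    "\<And>i. i < r \<Longrightarrow> cvec.span (A i) = Cs i"
    "\<And>i v j. i < r \<Longrightarrow> v \<in> A i \<Longrightarrow> v $ j \<in> rational_fls"
    by metis
  have direct: "direct_family {..<r} (\<lambda>i. cvec.span (A i))"
    unfolding direct_family_def
  proof
    fix i assume i: "i \<in> {..<r}"
    have "(\<Sum>j\<in>{..<r} - {i}. cvec.span (A j)) = (\<Sum>j\<in>{..<r} - {i}. Cs j)"
      by (rule sum.cong[OF refl]) (simp add: A(3))
    then show "cvec.span (A i) \<inter> (\<Sum>j\<in>{..<r} - {i}. cvec.span (A j)) = {0}"
      using assms(7) A(3) i unfolding direct_family_def by simp
  qed
  obtain A' :: "nat \<Rightarrow> ('a mod_ring fls ^ 'n) set"
    where A': "\<And>i. finite (A' i)" "\<And>i. cvec.independent (A' i)"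
      "\<And>i v j. v \<in> A' i \<Longrightarrow> v $ j \<in> rational_fls"
    and sum: "is_direct_sum {y. \<forall>x\<in>(\<Sum>i<r. scale_set (of_nat p ^ i) (cvec.span (A i))). dot y x = 0}
       {..<r} (\<lambda>i. scale_set (of_nat p ^ i) (cvec.span (A' i)))"
    and A'0: "cvec.span (A' 0) = {y. \<forall>x\<in>(\<Sum>i<r. cvec.span (A i)). dot y x = 0}"
    and card: "\<And>i. 0 < i \<Longrightarrow> i < r \<Longrightarrow> card (A' i) = card (A (r - i))"
    by (rule orthogonal_decomposition[OF A(1,2,4) direct], assumption+, rule that)
  have dual: "dual_code M = {y. \<forall>x\<in>M. dot y x = 0}" for M :: "('a mod_ring fls ^ 'n) set"
    by (simp add: dual_code_def dot_def)
  have "C = (\<Sum>i<r. scale_set (of_nat p ^ i) (cvec.span (A i)))"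
    using assms(6) unfolding is_direct_sum_def by (simp add: A(3))
  then have dual_sum: "is_direct_sum (dual_code C) {..<r}
      (\<lambda>i. scale_set (of_nat p ^ i) (cvec.span (A' i)))"
    using sum by (simp add: dual)
  have zeroth: "cvec.span (A' 0) = dual_code (\<Sum>i<r. Cs i)"
    unfolding A'0 dual by (simp add: A(3))
  have free: "free_convolutional_code (cvec.span (A' i))" for i
    unfolding free_convolutional_code_def free_submodule_def
  proof
    show "convolutional_code (cvec.span (A' i))"
      by (rule convolutional_code_span_rational[OF A'(1) A'(3)])
    show "\<exists>B. cvec.independent B \<and> cvec.span B = cvec.span (A' i)"
      using A'(2)[of i] by (intro exI[of _ "A' i"]) simp
  qed
  have rank: "free_rank (cvec.span (A' i)) = free_rank (Cs (r - i))" if "i \<in> {1..r - 1}" for i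
  proof -
    have i: "0 < i" "i < r" "r - i < r" using that by auto
    have "free_rank (cvec.span (A' i)) = card (A' i)" by (rule free_rank_span[OF A'(2,1)])
    also have "\<dots> = card (A (r - i))" by (rule card[OF i(1,2)])
    also have "\<dots> = free_rank (Cs (r - i))"
      using free_rank_span[OF A(2)[OF i(3)] A(1)[OF i(3)]] A(3)[OF i(3)] by simp
    finally show ?thesis .
  qed
  show ?thesis
    by (intro exI[of _ "\<lambda>i. cvec.span (A' i)"] conjI allI impI ballI free dual_sum zeroth rank)
qed

end
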